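(* Let $G$ be a graph and $\theta$ a real number. Let $H_1,\dots,H_q$ be the components of $G\setminus A_\theta(G)$ that are $\theta$-critical and $Q_1,\dots,Q_m$ the components of $G\setminus A_\theta(G)$ with $\mathrm{mult}(\theta,Q_j)=0$. Let $u,v$ be distinct vertices and suppose one of the following holds: (a) $u\in V(G)\setminus A_\theta(G)$ and $v\in V(Q_{j_0})$ for some $j_0$; (b) $u,v\in V(H_{i_0})$ for some $i_0$; (c) $\mathrm{mult}(\theta,G)\ge 2$, $u\in V(H_{i_1})$ and $v\in V(H_{i_2})$ with $i_1\neq i_2$. Then $A_\theta(G)$ is a $\theta$-extreme set in $S_\theta(G)\setminus\{u,v\}$, i.e. $\mathrm{mult}(\theta,S_\theta(G)\setminus(A_\theta(G)\cup\{u,v\}))=\mathrm{mult}(\theta,S_\theta(G)\setminus\{u,v\})+|A_\theta(G)|$.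
   Context: All graphs are finite and simple. For a graph $G$ on $n$ vertices, let $p(G,r)$ be the number of $r$-matchings of $G$ ($p(G,0)=1$); the matching polynomial is $\mu(G,x)=\sum_{r=0}^{\lfloor n/2\rfloor}(-1)^r p(G,r)x^{n-2r}$. For real $\theta$, $\mathrm{mult}(\theta,G)$ is the multiplicity of $\theta$ as a root of $\mu(G,x)$ (it is $0$ if $\theta$ is not a root). $G\setminus X$ denotes deletion of the vertex set $X$; $G\setminus u=G\setminus\{u\}$. A vertex $u$ is $\theta$-essential, $\theta$-neutral, or $\theta$-positive in $G$ according as $\mathrm{mult}(\theta,G\setminus u)$ equals $\mathrm{mult}(\theta,G)-1$, $\mathrm{mult}(\theta,G)$, or $\mathrm{mult}(\theta,G)+1$. A vertex is $\theta$-special if it is not $\theta$-essential but is adjacent to a $\theta$-essential vertex; $A_\theta(G)$ is the set of $\theta$-special vertices. A connected graph is $\theta$-critical if all its vertices are $\theta$-essential in it. Every component of $G\setminus A_\theta(G)$ is either $\theta$-critical or has $\mathrm{mult}(\theta,\cdot)=0$. $S_\theta(G)$ is the graph on $V(G)$ whose edges are the edges of $G$ together with all pairs $\{w,z\}$, $z\neq w$, with $w\in A_\theta(G)$. A set $X$ is $\theta$-extreme in a graph $F$ if $\mathrm{mult}(\theta,F\setminus X)=\mathrm{mult}(\theta,F)+|X|$. *)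

theory Defs
  imports "HOL-Computational_Algebra.Polynomial"
begin

type_synonym 'a graph = "'a set \<times> 'a set set"

definition simple_graph :: "'a graph \<Rightarrow> bool" where
  "simple_graph G \<longleftrightarrow> finite (fst G) \<and>
     (\<forall>e\<in>snd G. \<exists>x y. x \<noteq> y \<and> e = {x, y} \<and> x \<in> fst G \<and> y \<in> fst G)"

definition del_verts :: "'a graph \<Rightarrow> 'a set \<Rightarrow> 'a graph" where
  "del_verts G X = (fst G - X, {e \<in> snd G. e \<inter> X = {}})"

definition induced :: "'a graph \<Rightarrow> 'a set \<Rightarrow> 'a graph" where
  "induced G C = (C, {e \<in> snd G. e \<subseteq> C})"

definition num_matchings :: "'a graph \<Rightarrow> nat \<Rightarrow> nat" where
  "num_matchings G r = card {M. M \<subseteq> snd G \<and> card M = r \<and>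
      (\<forall>e\<in>M. \<forall>f\<in>M. e \<noteq> f \<longrightarrow> e \<inter> f = {})}"

definition match_poly :: "'a graph \<Rightarrow> real poly" where
  "match_poly G = (\<Sum>r\<le>card (fst G) div 2.
      monom ((-1) ^ r * real (num_matchings G r)) (card (fst G) - 2 * r))"

definition mult :: "real \<Rightarrow> 'a graph \<Rightarrow> nat" where
  "mult \<theta> G = order \<theta> (match_poly G)"

definition essential :: "real \<Rightarrow> 'a graph \<Rightarrow> 'a \<Rightarrow> bool" where
  "essential \<theta> G u \<longleftrightarrow> mult \<theta> (del_verts G {u}) + 1 = mult \<theta> G"

definition special_set :: "real \<Rightarrow> 'a graph \<Rightarrow> 'a set" where
  "special_set \<theta> G = {u \<in> fst G. \<not> essential \<theta> G u \<and>
      (\<exists>w\<in>fst G. essential \<theta> G w \<and> {u, w} \<in> snd G)}"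

definition adj :: "'a graph \<Rightarrow> 'a \<Rightarrow> 'a \<Rightarrow> bool" where
  "adj G x y \<longleftrightarrow> {x, y} \<in> snd G"

definition components :: "'a graph \<Rightarrow> 'a set set" where
  "components G = {{y \<in> fst G. (adj G)\<^sup>*\<^sup>* x y} | x. x \<in> fst G}"

definition connected_graph :: "'a graph \<Rightarrow> bool" where
  "connected_graph G \<longleftrightarrow> fst G \<noteq> {} \<and> (\<forall>x\<in>fst G. \<forall>y\<in>fst G. (adj G)\<^sup>*\<^sup>* x y)"

definition critical :: "real \<Rightarrow> 'a graph \<Rightarrow> bool" where
  "critical \<theta> G \<longleftrightarrow> connected_graph G \<and> (\<forall>u\<in>fst G. essential \<theta> G u)"

definition S_graph :: "real \<Rightarrow> 'a graph \<Rightarrow> 'a graph" where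
  "S_graph \<theta> G = (fst G, snd G \<union>
      {{w, z} | w z. w \<in> special_set \<theta> G \<and> z \<in> fst G \<and> z \<noteq> w})"

end

theory Submission
  imports Defs
begin

text \<open>
  Write \<open>f\<^sub>X\<close> for the matching polynomial of \<open>G\<close> with the vertex set \<open>X\<close> deleted. The vertex recursion yields
  the Rayleigh inequality \<open>f\<^sub>u f\<^sub>v - f f\<^sub>u\<^sub>v \<ge> 0\<close>, even for arbitrary real vertex weights. Comparing orders
  and leading coefficients at \<open>\<theta>\<close> in it gives interlacing, the fact that a vertex is positive iff it
  has a neighbour which is essential after its deletion, and the transitivity of the relation
  ``deleting both essential vertices lowers the multiplicity by at most one''. The latter implies the
  stability of special vertices, hence that deleting the set \<open>A\<close> of all special vertices raises the
  multiplicity by \<open>card A\<close>. So after deleting \<open>u\<close> and \<open>v\<close> as well, the multiplicity is still at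
  least \<open>card A\<close>. As long as the multiplicity is positive, adding a vertex adjacent to all others
  lowers it by exactly one, because an essential vertex exists and is a neighbour of the new one.
\<close>

subsection \<open>Weighted matching polynomials\<close>

definition matchings :: "'a graph \<Rightarrow> 'a set set set" where
  "matchings G = {M. M \<subseteq> snd G \<and> (\<forall>e\<in>M. \<forall>f\<in>M. e \<noteq> f \<longrightarrow> e \<inter> f = {})}"

text \<open>This is the multivariate matching polynomial, taken as a value at a weight vector. The
  constant weight x gives the matching polynomial at x; independent weights allow a single vertex to
  be perturbed in \<open>parallel_trans\<close>.\<close>

definition wmatch :: "('a \<Rightarrow> real) \<Rightarrow> 'a graph \<Rightarrow> real" where
  "wmatch c G = (\<Sum>M\<in>matchings G. (-1) ^ card M * (\<Prod>v\<in>fst G - \<Union>M. c v))"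

definition nbrs :: "'a graph \<Rightarrow> 'a \<Rightarrow> 'a set" where
  "nbrs G u = {w. {u, w} \<in> snd G}"

section \<open>Vertex deletion, edges and neighbourhoods\<close>

lemma fst_del_verts [simp]: "fst (del_verts G X) = fst G - X"
  by (simp add: del_verts_def)

lemma mem_snd_del_verts [simp]: "e \<in> snd (del_verts G X) \<longleftrightarrow> e \<in> snd G \<and> e \<inter> X = {}"
  by (simp add: del_verts_def)

lemma del_verts_del_verts [simp]: "del_verts (del_verts G X) Y = del_verts G (X \<union> Y)"
  by (auto simp: del_verts_def)

lemma del_verts_empty [simp]: "del_verts G {} = G"
  by (simp add: del_verts_def)

lemma simple_del_verts [simp]: "simple_graph G \<Longrightarrow> simple_graph (del_verts G X)"
  unfolding simple_graph_def by fastforce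

lemma finite_verts: "simple_graph G \<Longrightarrow> finite (fst G)"
  by (simp add: simple_graph_def)

lemma edgeE:
  assumes "simple_graph G" "e \<in> snd G"
  obtains x y where "x \<noteq> y" "e = {x, y}" "x \<in> fst G" "y \<in> fst G"
  using assms unfolding simple_graph_def by blast

lemma edge_subset: "simple_graph G \<Longrightarrow> e \<in> snd G \<Longrightarrow> e \<subseteq> fst G"
  by (auto elim: edgeE)

lemma edge_card: "simple_graph G \<Longrightarrow> e \<in> snd G \<Longrightarrow> card e = 2"
  by (auto elim!: edgeE)

lemma edge_doubleton: "simple_graph G \<Longrightarrow> {u, w} \<in> snd G \<Longrightarrow> u \<in> fst G \<and> w \<in> fst G \<and> u \<noteq> w"
  using edge_card[of G "{u, w}"] edge_subset[of G "{u, w}"] by (auto simp: card_insert_if split: if_splits)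

lemma finite_edges: "simple_graph G \<Longrightarrow> finite (snd G)"
  using edge_subset[of G] by (intro finite_subset[of "snd G" "Pow (fst G)"]) (blast, simp add: finite_verts)

lemma finite_matchings: "simple_graph G \<Longrightarrow> finite (matchings G)"
  unfolding matchings_def
  by (rule finite_subset[of _ "Pow (snd G)"]) (blast, simp add: finite_edges)

lemma finite_nbrs: "simple_graph G \<Longrightarrow> finite (nbrs G u)"
  by (rule finite_subset[OF _ finite_verts]) (auto simp: nbrs_def edge_doubleton)

lemma nbrs_in: "simple_graph G \<Longrightarrow> w \<in> nbrs G u \<Longrightarrow> w \<in> fst G \<and> w \<noteq> u"
  unfolding nbrs_def using edge_doubleton[of G u w] by blast

lemma nbrs_del: "u \<notin> X \<Longrightarrow> nbrs (del_verts G X) u = nbrs G u - X"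
  by (auto simp: nbrs_def)

lemma mem_matchings_del:
  "M \<in> matchings (del_verts G X) \<longleftrightarrow> M \<in> matchings G \<and> \<Union>M \<inter> X = {}"
  by (auto simp: matchings_def subset_iff)

section \<open>The vertex recursion\<close>

lemma matchings_split:
  assumes "simple_graph G"
  shows "matchings G = matchings (del_verts G {u}) \<union>
    (\<Union>w\<in>nbrs G u. insert {u, w} ` matchings (del_verts G {u, w}))"
proof (intro equalityI subsetI)
  fix M assume M: "M \<in> matchings G"
  show "M \<in> matchings (del_verts G {u}) \<union>
    (\<Union>w\<in>nbrs G u. insert {u, w} ` matchings (del_verts G {u, w}))"
  proof (cases "u \<in> \<Union>M")
    case False
    then show ?thesis using M by (simp add: mem_matchings_del)
  next
    case True
    then obtain e where e: "e \<in> M" "u \<in> e" by blast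
    moreover have "e \<in> snd G" using e M by (auto simp: matchings_def)
    ultimately obtain w where w: "e = {u, w}"
      using assms by (auto elim!: edgeE)
    have "\<forall>f\<in>M - {e}. e \<inter> f = {}"
      using M e unfolding matchings_def by blast
    then have "\<Union>(M - {e}) \<inter> {u, w} = {}"
      unfolding w by blast
    then have "M - {e} \<in> matchings (del_verts G {u, w})"
      using M by (simp add: mem_matchings_del) (auto simp: matchings_def)
    moreover have "M = insert {u, w} (M - {e})" using e w by auto
    moreover have "w \<in> nbrs G u" using \<open>e \<in> snd G\<close> w by (simp add: nbrs_def)
    ultimately show ?thesis by blast
  qed
next
  fix M assume "M \<in> matchings (del_verts G {u}) \<union>
    (\<Union>w\<in>nbrs G u. insert {u, w} ` matchings (del_verts G {u, w}))"
  then consider "M \<in> matchings G"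
    | w M' where "w \<in> nbrs G u" "M = insert {u, w} M'" "M' \<in> matchings G" "\<Union>M' \<inter> {u, w} = {}"
    by (auto simp only: mem_matchings_del)
  then show "M \<in> matchings G"
  proof cases
    case 2
    then have "\<forall>f\<in>M'. f \<inter> {u, w} = {}" by blast
    with 2 show ?thesis
      by (simp add: matchings_def nbrs_def Int_commute)
  qed
qed

lemma wmatch_rec:
  assumes "simple_graph G" "u \<in> fst G"
  shows "wmatch c G = c u * wmatch c (del_verts G {u})
           - (\<Sum>w\<in>nbrs G u. wmatch c (del_verts G {u, w}))"
proof -
  let ?t = "\<lambda>M. (-1) ^ card M * (\<Prod>v\<in>fst G - \<Union>M. c v)"
  let ?I = "\<lambda>w. insert {u, w} ` matchings (del_verts G {u, w})"
  \<comment> \<open>A matching has at most one edge at u, so the classes for different w cannot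
    overlap.\<close>
  have disj: "?I w \<inter> ?I w' = {}" if "w \<noteq> w'" for w w'
  proof -
    have "{u, w'} = {u, w}" if eq: "insert {u, w} M = insert {u, w'} M'"
      and M: "M \<in> matchings (del_verts G {u, w})" for M M'
    proof -
      have "{u, w'} \<in> insert {u, w} M" unfolding eq by simp
      moreover have "{u, w'} \<notin> M" using M by (auto simp: mem_matchings_del)
      ultimately show ?thesis by simp
    qed
    moreover have "{u, w'} \<noteq> {u, w}" using that by (simp add: doubleton_eq_iff)
    ultimately show ?thesis by (auto simp only:)
  qed
  have "wmatch c G = sum ?t (matchings (del_verts G {u})) + sum ?t (\<Union>w\<in>nbrs G u. ?I w)"
    unfolding wmatch_def matchings_split[OF assms(1), of u]
    by (rule sum.union_disjoint)
      (auto simp: finite_matchings finite_nbrs assms mem_matchings_del)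
  also have "sum ?t (\<Union>w\<in>nbrs G u. ?I w) = (\<Sum>w\<in>nbrs G u. sum ?t (?I w))"
    by (rule sum.UNION_disjoint) (use disj in \<open>auto simp: finite_matchings finite_nbrs assms\<close>)
  also have "\<dots> = (\<Sum>w\<in>nbrs G u. - wmatch c (del_verts G {u, w}))"
  proof (rule sum.cong[OF refl])
    fix w
    have "{u, w} \<notin> M" if "M \<in> matchings (del_verts G {u, w})" for M
      using that by (auto simp: mem_matchings_del)
    then have "inj_on (insert {u, w}) (matchings (del_verts G {u, w}))"
      by (intro inj_onI) (simp add: insert_ident)
    then have "sum ?t (?I w) = (\<Sum>M\<in>matchings (del_verts G {u, w}). ?t (insert {u, w} M))"
      by (simp add: sum.reindex)
    also have "\<dots> = (\<Sum>M\<in>matchings (del_verts G {u, w}).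
        - ((-1) ^ card M * (\<Prod>v\<in>fst (del_verts G {u, w}) - \<Union>M. c v)))"
    proof (rule sum.cong[OF refl])
      fix M assume M: "M \<in> matchings (del_verts G {u, w})"
      have "finite M"
        by (rule finite_subset[OF _ finite_edges[OF assms(1)]])
          (use M in \<open>auto simp: mem_matchings_del matchings_def\<close>)
      moreover have "{u, w} \<notin> M" using M by (auto simp: mem_matchings_del)
      moreover have "fst G - \<Union>(insert {u, w} M) = fst (del_verts G {u, w}) - \<Union>M" by auto
      ultimately show "?t (insert {u, w} M)
          = - ((-1) ^ card M * (\<Prod>v\<in>fst (del_verts G {u, w}) - \<Union>M. c v))"
        by (simp only: card_insert_disjoint power_Suc) simp
    qed
    finally show "sum ?t (?I w) = - wmatch c (del_verts G {u, w})"
      by (simp add: wmatch_def sum_negf)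
  qed
  also have "sum ?t (matchings (del_verts G {u})) = c u * wmatch c (del_verts G {u})"
    unfolding wmatch_def sum_distrib_left
  proof (rule sum.cong[OF refl])
    fix M assume M: "M \<in> matchings (del_verts G {u})"
    \<comment> \<open>A matching of G without u leaves u uncovered in G; this is the source of the
      factor \<open>c u\<close>.\<close>
    have "fst G - \<Union>M = insert u (fst (del_verts G {u}) - \<Union>M)"
      using M assms by (auto simp: mem_matchings_del)
    then show "?t M = c u * ((-1) ^ card M * (\<Prod>v\<in>fst (del_verts G {u}) - \<Union>M. c v))"
      using finite_verts[OF assms(1)] by simp
  qed
  finally show ?thesis by (simp add: sum_negf)
qed

lemma card_Union_matching:
  assumes "simple_graph G" "M \<in> matchings G"
  shows "card (\<Union>M) = 2 * card M" "\<Union>M \<subseteq> fst G"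
proof -
  have "card (\<Union>M) = (\<Sum>e\<in>M. card e)"
  proof (rule card_Union_disjoint)
    show "pairwise disjnt M" using assms(2) by (simp add: matchings_def pairwise_def disjnt_def)
    show "finite e" if "e \<in> M" for e
      using edge_card[OF assms(1), of e] assms(2) that
      by (intro card_ge_0_finite) (auto simp: matchings_def)
  qed
  also have "\<dots> = (\<Sum>e\<in>M. 2)"
    by (rule sum.cong[OF refl], rule edge_card[OF assms(1)])
      (use assms(2) in \<open>auto simp: matchings_def\<close>)
  finally show "card (\<Union>M) = 2 * card M" by simp
  show "\<Union>M \<subseteq> fst G"
    using assms(2) edge_subset[OF assms(1)] unfolding matchings_def by blast
qed

section \<open>The matching polynomial and its derivative\<close>

lemma poly_match_poly:
  assumes "simple_graph G"
  shows "poly (match_poly G) x = wmatch (\<lambda>_. x) G"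
proof -
  let ?n = "card (fst G)"
  let ?t = "\<lambda>M. (-1) ^ card M * x ^ (?n - 2 * card M)"
  have card_le: "card M \<le> ?n div 2" if "M \<in> matchings G" for M
    using card_Union_matching[OF assms that] card_mono[OF finite_verts[OF assms], of "\<Union>M"] by simp
  have "wmatch (\<lambda>_. x) G = (\<Sum>M\<in>matchings G. ?t M)"
    unfolding wmatch_def
  proof (rule sum.cong[OF refl])
    fix M assume "M \<in> matchings G"
    note cM = card_Union_matching[OF assms this]
    have "card (fst G - \<Union>M) = ?n - 2 * card M"
      using cM card_Diff_subset[of "\<Union>M" "fst G"] finite_subset[OF cM(2) finite_verts[OF assms]]
      by simp
    then show "(-1) ^ card M * (\<Prod>v\<in>fst G - \<Union>M. x) = ?t M" by simp
  qed
  also have "\<dots> = (\<Sum>r\<le>?n div 2. \<Sum>M\<in>{M \<in> matchings G. card M = r}. ?t M)"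
    by (rule sum.group[symmetric]) (use card_le in \<open>auto simp: finite_matchings assms\<close>)
  also have "\<dots> = (\<Sum>r\<le>?n div 2. (-1) ^ r * real (num_matchings G r) * x ^ (?n - 2 * r))"
  proof (rule sum.cong[OF refl])
    fix r
    have "(\<Sum>M\<in>{M \<in> matchings G. card M = r}. ?t M)
        = (\<Sum>M\<in>{M \<in> matchings G. card M = r}. (-1) ^ r * x ^ (?n - 2 * r))"
      by (rule sum.cong) auto
    moreover have "num_matchings G r = card {M \<in> matchings G. card M = r}"
      unfolding num_matchings_def by (rule arg_cong[of _ _ card]) (auto simp: matchings_def)
    ultimately show "(\<Sum>M\<in>{M \<in> matchings G. card M = r}. ?t M)
        = (-1) ^ r * real (num_matchings G r) * x ^ (?n - 2 * r)"
      by simp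
  qed
  finally show ?thesis by (simp add: match_poly_def poly_sum poly_monom)
qed

lemma match_poly_rec:
  assumes "simple_graph G" "u \<in> fst G"
  shows "match_poly G = [:0, 1:] * match_poly (del_verts G {u})
           - (\<Sum>w\<in>nbrs G u. match_poly (del_verts G {u, w}))"
proof -
  have "poly (match_poly G) x = poly ([:0, 1:] * match_poly (del_verts G {u})
           - (\<Sum>w\<in>nbrs G u. match_poly (del_verts G {u, w}))) x" for x
    using wmatch_rec[OF assms, of "\<lambda>_. x"] assms(1) by (simp add: poly_match_poly poly_sum)
  then show ?thesis by (intro iffD1[OF poly_eq_poly_eq_iff] ext)
qed

text \<open>The polynomial is monic: only the empty matching contributes in degree n. Nonvanishing
  is what makes \<open>order\<close> a genuine multiplicity.\<close>

lemma match_poly_nonzero: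
  assumes "simple_graph G"
  shows "match_poly G \<noteq> 0"
proof -
  let ?n = "card (fst G)"
  have "coeff (match_poly G) ?n = (\<Sum>r\<le>?n div 2. if r = 0 then real (num_matchings G 0) else 0)"
    unfolding match_poly_def coeff_sum
  proof (rule sum.cong[OF refl])
    fix r assume "r \<in> {..?n div 2}"
    then have "?n - 2 * r = ?n \<longleftrightarrow> r = 0" by auto
    then show "coeff (monom ((-1) ^ r * real (num_matchings G r)) (?n - 2 * r)) ?n
        = (if r = 0 then real (num_matchings G 0) else 0)"
      by (simp add: coeff_monom)
  qed
  also have "\<dots> = real (num_matchings G 0)" by simp
  finally have "coeff (match_poly G) ?n = real (num_matchings G 0)" .
  moreover have "M = {}" if "M \<subseteq> snd G" "card M = 0" for M
    using finite_subset[OF that(1) finite_edges[OF assms]] that(2) by simp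
  then have "{M. M \<subseteq> snd G \<and> card M = 0 \<and> (\<forall>e\<in>M. \<forall>f\<in>M. e \<noteq> f \<longrightarrow> e \<inter> f = {})} = {{}}"
    by (intro equalityI subsetI) (blast, simp)
  then have "num_matchings G 0 = 1" by (simp add: num_matchings_def)
  ultimately show ?thesis by auto
qed

text \<open>The recursion deletes one vertex or two, so the induction hypothesis covers every
  deletion that removes at least one vertex.\<close>

lemma graph_induct [consumes 1, case_names less]:
  assumes "simple_graph G"
    and "\<And>G. simple_graph G \<Longrightarrow>
      (\<And>X. X \<inter> fst G \<noteq> {} \<Longrightarrow> P (del_verts G X)) \<Longrightarrow> P G"
  shows "P G"
  using assms(1)
proof (induction "card (fst G)" arbitrary: G rule: less_induct)
  case less
  show ?case
  proof (rule assms(2)[OF less.prems])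
    fix X assume "X \<inter> fst G \<noteq> {}"
    then have "card (fst (del_verts G X)) < card (fst G)"
      by (intro psubset_card_mono) (auto simp: less.prems finite_verts)
    then show "P (del_verts G X)" using less by simp
  qed
qed

lemma pderiv_sum: "pderiv (\<Sum>i\<in>I. p i) = (\<Sum>i\<in>I. pderiv (p i))"
  for p :: "'b \<Rightarrow> real poly"
  by (induction I rule: infinite_finite_induct) (simp_all add: pderiv_add)

text \<open>Differentiate the recursion at a vertex u: the factor x yields the summand for u, and
  for every other v the remaining terms reassemble into the recursion at u in G without v.\<close>

lemma pderiv_match_poly:
  assumes "simple_graph G"
  shows "pderiv (match_poly G) = (\<Sum>v\<in>fst G. match_poly (del_verts G {v}))"
  using assms
proof (induction rule: graph_induct)
  case (less G)
  show ?case
  proof (cases "fst G = {}")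
    case True
    then have "snd G = {}" using edge_subset[OF less(1)] edge_card[OF less(1)] by fastforce
    with True show ?thesis
      by (simp add: match_poly_def pderiv_monom)
  next
    case False
    then obtain u where u: "u \<in> fst G" by blast
    let ?f = "\<lambda>X. match_poly (del_verts G X)"
    have IH: "pderiv (?f X) = (\<Sum>v\<in>fst G - X. ?f (insert v X))" if "u \<in> X" for X
      using less(2)[of X] that u by (auto simp: Un_commute)
    have fin: "finite (fst G)" "finite (nbrs G u)"
      using less(1) by (simp_all add: finite_verts finite_nbrs)
    have rec: "?f {v} = [:0, 1:] * ?f {u, v} - (\<Sum>w\<in>nbrs G u - {v}. ?f {u, v, w})"
      if "v \<in> fst G - {u}" for v
      using match_poly_rec[of "del_verts G {v}" u] that u less(1)
      by (auto simp: nbrs_del insert_commute)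
    have "pderiv (match_poly G) = ?f {u} + [:0, 1:] * (\<Sum>v\<in>fst G - {u}. ?f {v, u})
        - (\<Sum>w\<in>nbrs G u. \<Sum>v\<in>fst G - {u, w}. ?f {v, u, w})"
      unfolding match_poly_rec[OF less(1) u] pderiv_diff pderiv_mult pderiv_sum
      by (simp add: IH pderiv_pCons)
    \<comment> \<open>Exchanging the sums over v and w collects, for each v, exactly the neighbours
      of u that survive the deletion of v.\<close>
    also have "(\<Sum>w\<in>nbrs G u. \<Sum>v\<in>fst G - {u, w}. ?f {v, u, w})
        = (\<Sum>v\<in>fst G - {u}. \<Sum>w\<in>nbrs G u - {v}. ?f {u, v, w})"
    proof -
      have "(\<Sum>w\<in>nbrs G u. \<Sum>v\<in>fst G - {u, w}. ?f {v, u, w})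
          = (\<Sum>w\<in>nbrs G u. \<Sum>v | v \<in> fst G - {u} \<and> w \<noteq> v. ?f {u, v, w})"
        by (intro sum.cong) (auto simp: insert_commute)
      also have "\<dots> = (\<Sum>v\<in>fst G - {u}. \<Sum>w | w \<in> nbrs G u \<and> w \<noteq> v. ?f {u, v, w})"
        by (rule sum.swap_restrict) (use fin in auto)
      also have "\<dots> = (\<Sum>v\<in>fst G - {u}. \<Sum>w\<in>nbrs G u - {v}. ?f {u, v, w})"
        by (intro sum.cong) auto
      finally show ?thesis .
    qed
    also have "?f {u} + [:0, 1:] * (\<Sum>v\<in>fst G - {u}. ?f {v, u})
        - (\<Sum>v\<in>fst G - {u}. \<Sum>w\<in>nbrs G u - {v}. ?f {u, v, w})
        = ?f {u} + (\<Sum>v\<in>fst G - {u}. ?f {v})"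
      using rec by (simp add: sum_subtractf sum_distrib_left insert_commute[of _ u])
    also have "\<dots> = (\<Sum>v\<in>fst G. ?f {v})"
      using fin(1) u by (simp add: sum.remove)
    finally show ?thesis .
  qed
qed

section \<open>The Rayleigh inequality\<close>

lemma wmatch_cong: "(\<And>v. v \<in> fst G \<Longrightarrow> c v = d v) \<Longrightarrow> wmatch c G = wmatch d G"
  unfolding wmatch_def by (intro sum.cong prod.cong arg_cong2[of _ _ _ _ "(*)"]) auto

text \<open>Expand both \<open>f\<close> and \<open>f\<^sub>v\<close> by the recursion at u. The
  terms with \<open>c u\<close> cancel, and each neighbour w of u other than v contributes the
  Rayleigh difference of v and w in G without u, nonnegative by induction. The neighbour v itself,
  if present, contributes the square.\<close>

lemma rayleigh_weighted:
  assumes "simple_graph G" "u \<in> fst G" "v \<in> fst G" "u \<noteq> v"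
  shows "wmatch c (del_verts G {u}) * wmatch c (del_verts G {v})
      - wmatch c G * wmatch c (del_verts G {u, v})
      \<ge> (if {u, v} \<in> snd G then (wmatch c (del_verts G {u, v}))\<^sup>2 else 0)"
  using assms
proof (induction arbitrary: u v rule: graph_induct)
  case (less G)
  let ?f = "\<lambda>X. wmatch c (del_verts G X)"
  let ?N = "nbrs G u - {v}"
  have fin: "finite (nbrs G u)" using less(1) by (rule finite_nbrs)
  have v: "?f {v} = c u * ?f {u, v} - (\<Sum>w\<in>?N. ?f {u, v, w})"
    using wmatch_rec[of "del_verts G {v}" u c] less by (auto simp: nbrs_del insert_commute)
  have "(\<Sum>w\<in>nbrs G u. ?f {u, w}) = (if {u, v} \<in> snd G then ?f {u, v} else 0) + (\<Sum>w\<in>?N. ?f {u, w})"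
    using sum.remove[OF fin, of v "\<lambda>w. ?f {u, w}"] by (auto simp: nbrs_def)
  then have g: "wmatch c G = c u * ?f {u} - (if {u, v} \<in> snd G then ?f {u, v} else 0)
      - (\<Sum>w\<in>?N. ?f {u, w})"
    using wmatch_rec[OF less(1,3), of c] by simp
  have "0 \<le> (\<Sum>w\<in>?N. ?f {u, v} * ?f {u, w} - ?f {u} * ?f {u, v, w})"
  proof (rule sum_nonneg)
    fix w assume w: "w \<in> ?N"
    have ge: "0 \<le> (if P then y\<^sup>2 else 0)" for P and y :: real by simp
    have "v \<in> fst (del_verts G {u})" "w \<in> fst (del_verts G {u})" "v \<noteq> w" "{u} \<inter> fst G \<noteq> {}"
      using less w nbrs_in[OF less(1), of w u] by auto
    from order_trans[OF ge less(2)[OF this(4,1,2,3)]]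
    show "0 \<le> ?f {u, v} * ?f {u, w} - ?f {u} * ?f {u, v, w}" by (simp add: insert_commute)
  qed
  moreover have "?f {u} * ?f {v} - wmatch c G * ?f {u, v}
      = (\<Sum>w\<in>?N. ?f {u, v} * ?f {u, w} - ?f {u} * ?f {u, v, w})
        + (if {u, v} \<in> snd G then (?f {u, v})\<^sup>2 else 0)"
    unfolding v g sum_subtractf sum_distrib_left[symmetric]
    by (simp add: algebra_simps power2_eq_square)
  ultimately show ?case by simp
qed

subsection \<open>Multiplicities under vertex deletion\<close>

lemma tendsto_poly_within: "(poly q \<longlongrightarrow> poly q a) (at a within S)" for a :: real
  using poly_isCont[of a q] unfolding isCont_def by (rule tendsto_within_subset) simp

text \<open>To the right of \<theta> the power is positive, so q inherits the sign of p there, and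
  continuity carries it to \<theta>. This turns polynomial inequalities into signs of leading
  coefficients.\<close>

lemma cofactor_nonneg:
  fixes \<theta> :: real
  assumes "\<And>x. poly p x \<ge> 0" "p = [:-\<theta>, 1:] ^ n * q"
  shows "poly q \<theta> \<ge> 0"
proof (rule tendsto_lowerbound[OF tendsto_poly_within[of q \<theta> "{\<theta><..}"]])
  have "poly q x \<ge> 0" if "x > \<theta>" for x
    using assms(1)[of x] that zero_less_power[of "x - \<theta>" n]
    unfolding assms(2) by (simp add: zero_le_mult_iff not_le[symmetric])
  then show "\<forall>\<^sub>F x in at_right \<theta>. 0 \<le> poly q x"
    by (intro eventually_at_rightI[of \<theta> "\<theta> + 1"]) auto
qed simp

text \<open>To the left of \<theta> an odd power is negative, which reverses the sign. Combined with
  \<open>cofactor_nonneg\<close>: a nonzero polynomial that is nonnegative everywhere has no root of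
  odd order.\<close>

lemma cofactor_nonpos_odd:
  fixes \<theta> :: real
  assumes "\<And>x. poly p x \<ge> 0" "p = [:-\<theta>, 1:] ^ n * q" "odd n"
  shows "poly q \<theta> \<le> 0"
proof (rule tendsto_upperbound[OF tendsto_poly_within[of q \<theta> "{..<\<theta>}"]])
  have "poly q x \<le> 0" if "x < \<theta>" for x
  proof -
    have "(x - \<theta>) ^ n < 0" using that assms(3) by simp
    moreover have "(x - \<theta>) ^ n * poly q x \<ge> 0"
      using assms(1)[of x] unfolding assms(2) by simp
    ultimately show ?thesis using mult_neg_pos[of "(x - \<theta>) ^ n" "poly q x"] by linarith
  qed
  then show "\<forall>\<^sub>F x in at_left \<theta>. poly q x \<le> 0"
    by (intro eventually_at_leftI[of "\<theta> - 1" \<theta>]) auto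
qed simp

text \<open>The extra linear factor avoids the exponent n - 1, so that n = 0 fits the same
  formula.\<close>

lemma pderiv_power_mult:
  fixes \<theta> :: real
  shows "[:-\<theta>, 1:] * pderiv ([:-\<theta>, 1:] ^ n * g)
    = [:-\<theta>, 1:] ^ n * (smult (real n) g + [:-\<theta>, 1:] * pderiv g)"
proof (cases n)
  case (Suc k)
  have "pderiv [:-\<theta>, 1:] = 1" by (simp add: pderiv_pCons)
  then show ?thesis
    unfolding Suc pderiv_mult pderiv_power_Suc
    by (simp only: mult_1_left mult_1_right of_nat_Suc power_Suc mult_smult_left mult_smult_right distrib_left ac_simps)
qed simp

lemma mult_ge_iff: "simple_graph G \<Longrightarrow> n \<le> mult \<theta> G \<longleftrightarrow> [:-\<theta>, 1:] ^ n dvd match_poly G"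
  by (simp add: mult_def order_divides match_poly_nonzero)

lemma mult_factor:
  assumes "simple_graph G" "match_poly G = [:-\<theta>, 1:] ^ n * g"
  shows "n \<le> mult \<theta> G" "poly g \<theta> = 0 \<longleftrightarrow> n < mult \<theta> G"
proof -
  show "n \<le> mult \<theta> G" by (simp add: mult_ge_iff assms)
  have "Suc n \<le> mult \<theta> G \<longleftrightarrow> [:-\<theta>, 1:] ^ n * [:-\<theta>, 1:] dvd [:-\<theta>, 1:] ^ n * g"
    by (simp only: mult_ge_iff[OF assms(1)] assms(2) power_Suc2)
  also have "\<dots> \<longleftrightarrow> poly g \<theta> = 0"
    by (simp only: dvd_mult_cancel_left poly_eq_0_iff_dvd) simp
  finally show "poly g \<theta> = 0 \<longleftrightarrow> n < mult \<theta> G" by auto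
qed

lemma mult_factorE:
  assumes "simple_graph G" "n \<le> mult \<theta> G"
  obtains g where "match_poly G = [:-\<theta>, 1:] ^ n * g" "poly g \<theta> = 0 \<longleftrightarrow> n < mult \<theta> G"
  using assms mult_factor by (metis dvdE mult_ge_iff)

lemma mult_exactE:
  assumes "simple_graph G" "mult \<theta> G = n"
  obtains g where "match_poly G = [:-\<theta>, 1:] ^ n * g" "poly g \<theta> \<noteq> 0"
  using mult_factorE[OF assms(1) eq_refl[OF assms(2)[symmetric]]] assms(2) by blast

lemma mult_leE:
  assumes "simple_graph G" "n \<le> mult \<theta> G"
  obtains g where "match_poly G = [:-\<theta>, 1:] ^ n * g"
  using mult_factorE[OF assms] by blast

section \<open>Wronskian inequality and interlacing\<close>

lemma rayleigh:
  assumes "simple_graph G" "u \<in> fst G" "v \<in> fst G" "u \<noteq> v"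
  shows "poly (match_poly (del_verts G {u}) * match_poly (del_verts G {v})
      - match_poly G * match_poly (del_verts G {u, v})) x
    \<ge> (if {u, v} \<in> snd G then (poly (match_poly (del_verts G {u, v})) x)\<^sup>2 else 0)"
  using rayleigh_weighted[OF assms, of "\<lambda>_. x"] assms(1)
  by (cases "{u, v} \<in> snd G") (simp_all add: poly_match_poly)

lemma rayleigh_nonneg:
  assumes "simple_graph G" "u \<in> fst G" "v \<in> fst G" "u \<noteq> v"
  shows "poly (match_poly (del_verts G {u}) * match_poly (del_verts G {v})
      - match_poly G * match_poly (del_verts G {u, v})) x \<ge> 0"
proof (rule order_trans[OF _ rayleigh[OF assms]])
qed simp

text \<open>Sum the Rayleigh inequality over all v other than u. By \<open>pderiv_match_poly\<close>
  the sums are derivatives, except that the one for \<open>f\<close> also has the summand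
  \<open>f\<^sub>u\<close>, which leaves the square.\<close>

lemma wronskian_ge:
  assumes "simple_graph G" "u \<in> fst G"
  shows "poly (pderiv (match_poly G) * match_poly (del_verts G {u})
      - match_poly G * pderiv (match_poly (del_verts G {u}))) x
    \<ge> (poly (match_poly (del_verts G {u})) x)\<^sup>2"
proof -
  let ?f = "\<lambda>X. poly (match_poly (del_verts G X)) x"
  have fin: "finite (fst G)" using assms(1) by (rule finite_verts)
  have "0 \<le> (\<Sum>v\<in>fst G - {u}. ?f {u} * ?f {v} - poly (match_poly G) x * ?f {u, v})"
    using rayleigh_nonneg[OF assms] by (intro sum_nonneg) auto
  moreover have "\<dots> = ?f {u} * (\<Sum>v\<in>fst G - {u}. ?f {v})
      - poly (match_poly G) x * (\<Sum>v\<in>fst G - {u}. ?f {u, v})"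
    by (simp add: sum_subtractf sum_distrib_left)
  moreover have "poly (pderiv (match_poly G)) x = ?f {u} + (\<Sum>v\<in>fst G - {u}. ?f {v})"
    using assms fin by (simp add: pderiv_match_poly poly_sum sum.remove)
  moreover have "poly (pderiv (match_poly (del_verts G {u}))) x = (\<Sum>v\<in>fst G - {u}. ?f {u, v})"
    using assms by (simp add: pderiv_match_poly poly_sum insert_commute)
  ultimately show ?thesis
    by (simp add: algebra_simps power2_eq_square)
qed

text \<open>The Wronskian has its leading term at order m + n - 1; the linear factor on the left
  again avoids the subtraction. The exponents may be lower bounds for the orders, as in
  \<open>mult_le_del\<close>.\<close>

lemma wronskian_factor:
  fixes \<theta> :: real
  assumes "p = [:-\<theta>, 1:] ^ m * h" "q = [:-\<theta>, 1:] ^ n * g"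
  obtains r where "[:-\<theta>, 1:] * (pderiv p * q - p * pderiv q) = [:-\<theta>, 1:] ^ (m + n) * r"
    "poly r \<theta> = (real m - real n) * poly h \<theta> * poly g \<theta>"
proof
  let ?t = "[:-\<theta>, 1:]"
  let ?r = "(smult (real m) h + ?t * pderiv h) * g - h * (smult (real n) g + ?t * pderiv g)"
  have "?t * (pderiv p * q - p * pderiv q) = (?t * pderiv p) * q - p * (?t * pderiv q)"
    by (simp only: algebra_simps)
  also have "\<dots> = ?t ^ (m + n) * ?r"
    unfolding assms pderiv_power_mult by (simp only: power_add algebra_simps)
  finally show "?t * (pderiv p * q - p * pderiv q) = ?t ^ (m + n) * ?r" .
  show "poly ?r \<theta> = (real m - real n) * poly h \<theta> * poly g \<theta>"
    by (simp add: algebra_simps)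
qed

text \<open>If the multiplicity dropped by two or more, the Wronskian would vanish to order at least
  2n + 1 at \<theta>, while the square it dominates has order exactly 2n. Their difference would
  then be negative near \<theta>.\<close>

lemma mult_le_del:
  assumes "simple_graph G" "u \<in> fst G"
  shows "mult \<theta> G \<le> mult \<theta> (del_verts G {u}) + 1"
proof (rule ccontr)
  let ?t = "[:-\<theta>, 1:]"
  define n where "n = mult \<theta> (del_verts G {u})"
  assume "\<not> ?thesis"
  then have "n + 2 \<le> mult \<theta> G" by (simp add: n_def)
  then obtain h where h: "match_poly G = ?t ^ (n + 2) * h"
    by (rule mult_leE[OF assms(1)])
  obtain g where g: "match_poly (del_verts G {u}) = ?t ^ n * g" "poly g \<theta> \<noteq> 0"
    by (rule mult_exactE[OF simple_del_verts[OF assms(1)] n_def[symmetric]])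
  let ?W = "pderiv (match_poly G) * match_poly (del_verts G {u})
      - match_poly G * pderiv (match_poly (del_verts G {u}))"
  obtain r where "?t * ?W = ?t ^ (n + 2 + n) * r"
    using wronskian_factor[OF h g(1)] by blast
  also have "\<dots> = ?t * (?t ^ (n + n) * (?t * r))"
    by (simp only: power_add power2_eq_square ac_simps)
  finally have "?W = ?t ^ (n + n) * (?t * r)"
    by (simp only: mult_cancel_left) auto
  then have "?W - (match_poly (del_verts G {u}))\<^sup>2
      = ?t ^ (n + n) * (?t * r) - (match_poly (del_verts G {u}))\<^sup>2"
    by (rule arg_cong)
  also have "\<dots> = ?t ^ (n + n) * (?t * r - g\<^sup>2)"
    unfolding g(1) by (simp only: power2_eq_square power_add algebra_simps)
  finally have "?W - (match_poly (del_verts G {u}))\<^sup>2 = ?t ^ (n + n) * (?t * r - g\<^sup>2)" .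
  moreover have "poly (?W - (match_poly (del_verts G {u}))\<^sup>2) x \<ge> 0" for x
    using wronskian_ge[OF assms, of x] by simp
  ultimately have "poly (?t * r - g\<^sup>2) \<theta> \<ge> 0" by (rule cofactor_nonneg[rotated])
  with g(2) show False by simp
qed

text \<open>The residues of \<open>f\<^sub>u / f\<close> at a real point are nonnegative, so that simple poles cannot cancel
  in the vertex recursion.\<close>

lemma residue_nonneg:
  assumes "simple_graph G" "u \<in> fst G"
    and "match_poly G = [:-\<theta>, 1:] ^ (n + 1) * h"
    and "match_poly (del_verts G {u}) = [:-\<theta>, 1:] ^ n * g"
  shows "poly h \<theta> * poly g \<theta> \<ge> 0"
proof -
  let ?t = "[:-\<theta>, 1:]"
  let ?W = "pderiv (match_poly G) * match_poly (del_verts G {u})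
      - match_poly G * pderiv (match_poly (del_verts G {u}))"
  obtain r where r: "?t * ?W = ?t ^ (n + 1 + n) * r" "poly r \<theta> = poly h \<theta> * poly g \<theta>"
    using wronskian_factor[OF assms(3,4)] by auto
  note r(1)
  also have "?t ^ (n + 1 + n) * r = ?t * (?t ^ (n + n) * r)"
    by (simp only: power_add power_one_right ac_simps)
  finally have "?W = ?t ^ (n + n) * r"
    by (simp only: mult_cancel_left) auto
  moreover have "poly ?W x \<ge> 0" for x
    using wronskian_ge[OF assms(1,2), of x] by (rule order_trans[rotated]) simp
  ultimately have "poly r \<theta> \<ge> 0" by (rule cofactor_nonneg[rotated])
  with r(2) show ?thesis by simp
qed

section \<open>Changes of multiplicity and essential vertices\<close>

lemma mult_del_le_if:
  assumes "simple_graph G" "a \<in> fst G" "n \<le> mult \<theta> (del_verts G {a})"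
    and "\<And>y. y \<in> nbrs G a \<Longrightarrow> n \<le> mult \<theta> (del_verts G {a, y})"
  shows "n \<le> mult \<theta> G"
proof -
  have dvd: "[:-\<theta>, 1:] ^ n dvd match_poly (del_verts G X)" if "n \<le> mult \<theta> (del_verts G X)" for X
    using that mult_ge_iff[OF simple_del_verts[OF assms(1)]] by blast
  show ?thesis
    unfolding mult_ge_iff[OF assms(1)] match_poly_rec[OF assms(1,2)]
    by (intro dvd_diff dvd_mult dvd_sum dvd assms(3,4))
qed

text \<open>By \<open>mult_le_del\<close>, deleting a neighbour y after a loses at most one, so
  every term of the recursion at a has order at least that of \<open>f\<^sub>a\<close> minus
  one.\<close>

lemma mult_del_le:
  assumes "simple_graph G" "a \<in> fst G"
  shows "mult \<theta> (del_verts G {a}) \<le> mult \<theta> G + 1"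
proof -
  have "mult \<theta> (del_verts G {a}) - 1 \<le> mult \<theta> G"
  proof (rule mult_del_le_if[OF assms])
    fix y assume "y \<in> nbrs G a"
    then show "mult \<theta> (del_verts G {a}) - 1 \<le> mult \<theta> (del_verts G {a, y})"
      using mult_le_del[of "del_verts G {a}" y \<theta>] nbrs_in[OF assms(1)] assms(1)
      by (simp add: le_diff_conv insert_commute)
  qed simp
  then show ?thesis by simp
qed

text \<open>In the recursion at a, the term with \<open>f\<^sub>a\<close> has order at least k + 1.
  At order k the neighbour terms have coefficients that, by \<open>residue_nonneg\<close>, are never
  opposite in sign to the leading coefficient of \<open>f\<^sub>a\<close>. The one for y is nonzero,
  so the sum cannot cancel and \<open>f\<close> has order exactly k.\<close>

lemma mult_del_essential_nbr:
  assumes "simple_graph G" "a \<in> fst G" "y \<in> nbrs G a"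
    and "mult \<theta> (del_verts G {a, y}) + 1 = mult \<theta> (del_verts G {a})"
  shows "mult \<theta> G + 1 = mult \<theta> (del_verts G {a})"
proof -
  let ?t = "[:-\<theta>, 1:]"
  define k where "k = mult \<theta> (del_verts G {a, y})"
  have nb: "z \<in> fst (del_verts G {a})" if "z \<in> nbrs G a" for z
    using nbrs_in[OF assms(1) that] by simp
  obtain g where g: "match_poly (del_verts G {a}) = ?t ^ (k + 1) * g" "poly g \<theta> \<noteq> 0"
    by (rule mult_exactE[OF simple_del_verts[OF assms(1)] assms(4)[symmetric, folded k_def]])
  have "\<forall>z\<in>nbrs G a. \<exists>q. match_poly (del_verts G {a, z}) = ?t ^ k * q"
  proof
    fix z assume "z \<in> nbrs G a"
    from mult_le_del[OF simple_del_verts[OF assms(1)] nb[OF this], of \<theta>] assms(4)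
    have "k \<le> mult \<theta> (del_verts G {a, z})"
      by (simp add: k_def insert_commute)
    then show "\<exists>q. match_poly (del_verts G {a, z}) = ?t ^ k * q"
      by (rule mult_leE[OF simple_del_verts[OF assms(1)]]) blast
  qed
  from bchoice[OF this] obtain q
    where q: "\<And>z. z \<in> nbrs G a \<Longrightarrow> match_poly (del_verts G {a, z}) = ?t ^ k * q z"
    by blast
  have nonneg: "poly g \<theta> * poly (q z) \<theta> \<ge> 0" if "z \<in> nbrs G a" for z
  proof (rule residue_nonneg[OF simple_del_verts[OF assms(1)] nb[OF that] g(1)])
    show "match_poly (del_verts (del_verts G {a}) {z}) = ?t ^ k * q z"
      using q[OF that] by (simp only: del_verts_del_verts Un_insert_left Un_empty_left)
  qed
  have "poly (q y) \<theta> \<noteq> 0"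
    using mult_factor(2)[of "del_verts G {a, y}" \<theta> k "q y"] q[OF assms(3)] assms(1)
    by (simp add: k_def)
  then have "0 < (\<Sum>z\<in>nbrs G a. poly g \<theta> * poly (q z) \<theta>)"
    using nonneg[OF assms(3)] g(2) nonneg
    by (intro sum_pos2[OF finite_nbrs[OF assms(1)] assms(3)]) (simp_all add: order.strict_iff_order)
  then have "0 < poly g \<theta> * (\<Sum>z\<in>nbrs G a. poly (q z) \<theta>)"
    by (simp only: sum_distrib_left)
  then have "(\<Sum>z\<in>nbrs G a. poly (q z) \<theta>) \<noteq> 0"
    by (intro notI) simp
  then have "poly ([:0, 1:] * ?t * g - (\<Sum>z\<in>nbrs G a. q z)) \<theta> \<noteq> 0"
    by (simp add: poly_sum)
  moreover have "match_poly G = ?t ^ k * ([:0, 1:] * ?t * g - (\<Sum>z\<in>nbrs G a. q z))"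
  proof -
    have "(\<Sum>z\<in>nbrs G a. match_poly (del_verts G {a, z})) = ?t ^ k * (\<Sum>z\<in>nbrs G a. q z)"
      unfolding sum_distrib_left by (rule sum.cong[OF refl q])
    then show ?thesis
      unfolding match_poly_rec[OF assms(1,2)] g(1)
      by (simp only: power_add power_one_right right_diff_distrib ac_simps)
  qed
  ultimately have "k \<le> mult \<theta> G" "\<not> k < mult \<theta> G"
    using mult_factor[OF assms(1)] by blast+
  then show ?thesis using assms(4) by (simp add: k_def)
qed

text \<open>The derivative has order m - 1 at a root of order m, and it is the sum of the
  polynomials of the vertex-deleted graphs; hence not all of these have order at least m.\<close>

lemma exists_essential:
  assumes "simple_graph G" "mult \<theta> G \<ge> 1"
  obtains v where "v \<in> fst G" "mult \<theta> (del_verts G {v}) + 1 = mult \<theta> G"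
proof -
  let ?t = "[:-\<theta>, 1:]"
  define m where "m = mult \<theta> G"
  have "\<exists>v\<in>fst G. mult \<theta> (del_verts G {v}) < m"
  proof (rule ccontr)
    assume "\<not> ?thesis"
    then have "?t ^ m dvd pderiv (match_poly G)"
      using assms(1) by (auto simp: pderiv_match_poly mult_ge_iff[symmetric] not_less intro!: dvd_sum)
    then obtain s where s: "pderiv (match_poly G) = ?t ^ m * s" by blast
    obtain h where h: "match_poly G = ?t ^ m * h" "poly h \<theta> \<noteq> 0"
      by (rule mult_exactE[OF assms(1) m_def[symmetric]])
    have "?t ^ m * (?t * s) = ?t * pderiv (?t ^ m * h)"
      unfolding h(1)[symmetric] s by (simp only: ac_simps)
    also have "\<dots> = ?t ^ m * (smult (real m) h + ?t * pderiv h)"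
      by (rule pderiv_power_mult)
    finally have "?t * s = smult (real m) h + ?t * pderiv h"
      by (simp only: mult_cancel_left) auto
    then have "poly (?t * s) \<theta> = poly (smult (real m) h + ?t * pderiv h) \<theta>" by simp
    with h(2) assms(2) show False by (simp add: m_def)
  qed
  then obtain v where v: "v \<in> fst G" "mult \<theta> (del_verts G {v}) < mult \<theta> G"
    by (auto simp: m_def)
  show ?thesis
    by (rule that[OF v(1)]) (use v(2) mult_le_del[OF assms(1) v(1), of \<theta>] in linarith)
qed

text \<open>If the conclusion fails, the nonnegative Rayleigh difference would have odd order at \<open>\<theta>\<close>.\<close>

lemma mult_del_essential_comm:
  assumes "simple_graph G" "a \<in> fst G" "w \<in> fst G" "a \<noteq> w"
    and "mult \<theta> (del_verts G {w}) + 1 = mult \<theta> G"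
    and "mult \<theta> G \<le> mult \<theta> (del_verts G {a})"
  shows "mult \<theta> (del_verts G {a, w}) + 1 = mult \<theta> (del_verts G {a})"
proof -
  let ?t = "[:-\<theta>, 1:]"
  have 1: "mult \<theta> (del_verts G {a}) \<le> mult \<theta> (del_verts G {a, w}) + 1"
    using mult_le_del[of "del_verts G {a}" w \<theta>] assms by (simp add: insert_commute)
  have 2: "mult \<theta> (del_verts G {a, w}) \<le> mult \<theta> G"
    using mult_del_le[of "del_verts G {w}" a \<theta>] assms by (simp add: insert_commute)
  have "mult \<theta> (del_verts G {a}) \<noteq> mult \<theta> (del_verts G {a, w})"
  proof
    assume eq: "mult \<theta> (del_verts G {a}) = mult \<theta> (del_verts G {a, w})"
    define k where "k = mult \<theta> (del_verts G {w})"
    have m: "mult \<theta> G = k + 1" "mult \<theta> (del_verts G {a}) = k + 1"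
      "mult \<theta> (del_verts G {a, w}) = k + 1"
      using eq 2 assms(5,6) by (simp_all add: k_def)
    obtain fa where fa: "match_poly (del_verts G {a}) = ?t ^ (k + 1) * fa" "poly fa \<theta> \<noteq> 0"
      by (rule mult_exactE[OF simple_del_verts[OF assms(1)] m(2)])
    obtain fw where fw: "match_poly (del_verts G {w}) = ?t ^ k * fw" "poly fw \<theta> \<noteq> 0"
      by (rule mult_exactE[OF simple_del_verts[OF assms(1)] k_def[symmetric]])
    obtain h where h: "match_poly G = ?t ^ (k + 1) * h"
      by (rule mult_exactE[OF assms(1) m(1)])
    obtain e where e: "match_poly (del_verts G {a, w}) = ?t ^ (k + 1) * e"
      by (rule mult_exactE[OF simple_del_verts[OF assms(1)] m(3)])
    let ?D = "match_poly (del_verts G {a}) * match_poly (del_verts G {w})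
      - match_poly G * match_poly (del_verts G {a, w})"
    have D: "?D = ?t ^ (k + k + 1) * (fa * fw - ?t * h * e)"
      unfolding fa(1) fw(1) h e by (simp only: power_add power_one_right algebra_simps)
    have nn: "poly ?D x \<ge> 0" for x
      using rayleigh_nonneg[OF assms(1-4)] .
    have "poly (fa * fw - ?t * h * e) \<theta> = 0"
      using cofactor_nonneg[OF nn D] cofactor_nonpos_odd[OF nn D] by simp
    with fa(2) fw(2) show False by simp
  qed
  with 1 2 assms(5,6) show ?thesis by linarith
qed

text \<open>Here the square term of the Rayleigh inequality matters. If the multiplicity dropped by
  two or more, both products would vanish to order at least 2j + 2 by interlacing, but the square
  has order exactly 2j.\<close>

lemma mult_del_edge:
  assumes "simple_graph G" "{u, v} \<in> snd G"
  shows "mult \<theta> G \<le> mult \<theta> (del_verts G {u, v}) + 1"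
proof (rule ccontr)
  let ?t = "[:-\<theta>, 1:]"
  define j where "j = mult \<theta> (del_verts G {u, v})"
  have uv: "u \<in> fst G" "v \<in> fst G" "u \<noteq> v" using edge_doubleton[OF assms] by auto
  assume "\<not> ?thesis"
  then have m: "j + 2 \<le> mult \<theta> G" by (simp add: j_def)
  obtain h where h: "match_poly G = ?t ^ (j + 2) * h"
    by (rule mult_leE[OF assms(1) m])
  obtain fu where fu: "match_poly (del_verts G {u}) = ?t ^ (j + 1) * fu"
    by (rule mult_leE[OF simple_del_verts[OF assms(1)], of "j + 1" \<theta> "{u}"])
      (use m mult_le_del[OF assms(1) uv(1), of \<theta>] in linarith)
  obtain fv where fv: "match_poly (del_verts G {v}) = ?t ^ (j + 1) * fv"
    by (rule mult_leE[OF simple_del_verts[OF assms(1)], of "j + 1" \<theta> "{v}"])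
      (use m mult_le_del[OF assms(1) uv(2), of \<theta>] in linarith)
  obtain g where g: "match_poly (del_verts G {u, v}) = ?t ^ j * g" "poly g \<theta> \<noteq> 0"
    by (rule mult_exactE[OF simple_del_verts[OF assms(1)] j_def[symmetric]])
  let ?D = "match_poly (del_verts G {u}) * match_poly (del_verts G {v})
      - match_poly G * match_poly (del_verts G {u, v}) - (match_poly (del_verts G {u, v}))\<^sup>2"
  have "poly ?D x \<ge> 0" for x
    using rayleigh[OF assms(1) uv, of x] assms(2) by simp
  moreover have "?D = ?t ^ (j + j) * (?t\<^sup>2 * fu * fv - ?t\<^sup>2 * h * g - g\<^sup>2)"
    unfolding h fu fv g(1) by (simp only: power_add power_one_right power2_eq_square algebra_simps)
  ultimately have "poly (?t\<^sup>2 * fu * fv - ?t\<^sup>2 * h * g - g\<^sup>2) \<theta> \<ge> 0" by (rule cofactor_nonneg)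
  with g(2) show False by simp
qed

text \<open>Only the first term of the recursion at a involves the weight of a, so the dependence on
  it is affine.\<close>

lemma wmatch_upd:
  assumes "simple_graph G" "a \<in> fst G"
  shows "wmatch ((\<lambda>_. x)(a := x + s)) G
    = poly (match_poly G) x + s * poly (match_poly (del_verts G {a})) x"
proof -
  have *: "wmatch ((\<lambda>_. x)(a := x + s)) (del_verts G X) = wmatch (\<lambda>_. x) (del_verts G X)"
    if "a \<in> X" for X
    by (rule wmatch_cong) (use that in auto)
  show ?thesis
    unfolding poly_match_poly[OF assms(1)] poly_match_poly[OF simple_del_verts[OF assms(1)]]
      wmatch_rec[OF assms]
    by (simp add: * distrib_right)
qed

text \<open>The weight of \<open>a\<close> is perturbed by \<open>s (x - \<theta>)\<close>: if the claim fails, the leading coefficient at \<open>\<theta>\<close>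
  of the Rayleigh difference for \<open>w\<close> and \<open>b\<close> is a nonconstant affine function of \<open>s\<close>, hence negative for
  some \<open>s\<close>.\<close>

lemma parallel_trans:
  assumes "simple_graph G" "a \<in> fst G" "b \<in> fst G" "w \<in> fst G" "a \<noteq> b" "w \<noteq> b" "a \<noteq> w"
    and "mult \<theta> (del_verts G {b}) + 1 = mult \<theta> G"
    and "mult \<theta> G \<le> mult \<theta> (del_verts G {b, w}) + 1"
    and "mult \<theta> G \<le> mult \<theta> (del_verts G {b, a}) + 1"
  shows "mult \<theta> G \<le> mult \<theta> (del_verts G {w, a}) + 1"
proof (rule ccontr)
  let ?t = "[:-\<theta>, 1:]"
  let ?f = "\<lambda>X. match_poly (del_verts G X)"
  define j where "j = mult \<theta> (del_verts G {w, a})"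
  assume "\<not> ?thesis"
  then have m: "j + 2 \<le> mult \<theta> G" by (simp add: j_def)
  have le: "mult \<theta> (del_verts G X) \<le> mult \<theta> (del_verts G (insert z X)) + 1"
    if "z \<in> fst G" "z \<notin> X" for z X
    using mult_le_del[of "del_verts G X" z \<theta>] assms(1) that by simp
  have fac: "\<exists>q. ?f X = ?t ^ n * q" if "n \<le> mult \<theta> (del_verts G X)" for n X
    by (rule mult_leE[OF simple_del_verts[OF assms(1)] that]) blast
  \<comment> \<open>Two deletions lose at most two, so the assumed lower bound is attained.\<close>
  have meq: "mult \<theta> G = j + 2"
    using m le[of w "{}"] le[of a "{w}"] assms by (simp add: j_def insert_commute)
  obtain h where h: "match_poly G = ?t ^ (j + 2) * h"
    using fac[of "j + 2" "{}"] m by auto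
  obtain fw where fw: "?f {w} = ?t ^ (j + 1) * fw"
    using fac[of "j + 1" "{w}"] m le[of w "{}"] assms(4) by auto
  obtain fa where fa: "?f {a} = ?t ^ (j + 1) * fa"
    using fac[of "j + 1" "{a}"] m le[of a "{}"] assms(2) by auto
  obtain fb where fb: "?f {b} = ?t ^ (j + 1) * fb" "poly fb \<theta> \<noteq> 0"
    by (rule mult_exactE[OF simple_del_verts[OF assms(1)], of \<theta> "{b}" "j + 1"])
      (use meq assms(8) in linarith)
  obtain fwa where fwa: "?f {w, a} = ?t ^ j * fwa" "poly fwa \<theta> \<noteq> 0"
    by (rule mult_exactE[OF simple_del_verts[OF assms(1)] j_def[symmetric]])
  obtain fba where fba: "?f {b, a} = ?t ^ (j + 1) * fba"
    using fac[of "j + 1" "{b, a}"] meq assms by auto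
  obtain fwb where fwb: "?f {w, b} = ?t ^ (j + 1) * fwb"
    using fac[of "j + 1" "{w, b}"] meq assms by (auto simp: insert_commute)
  obtain fwba where fwba: "?f {w, b, a} = ?t ^ j * fwba"
    using fac[of j "{w, b, a}"] meq assms le[of w "{b, a}"] by auto
  \<comment> \<open>This s makes the leading coefficient of \<open>?D\<close>, of order 2j + 2,
    equal to minus the square of \<open>poly fb \<theta>\<close>. The factor \<open>?t\<close> in
    \<open>?s\<close> lifts \<open>f\<^sub>w\<^sub>a\<close>, of order j, to the order j + 1 at
    which \<open>fw\<close> is read off.\<close>
  define s where "s = (- poly fb \<theta> - poly fw \<theta>) / poly fwa \<theta>"
  let ?s = "[:s:] * ?t"
  let ?D = "(?f {w} + ?s * ?f {w, a}) * (?f {b} + ?s * ?f {b, a})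
    - (match_poly G + ?s * ?f {a}) * (?f {w, b} + ?s * ?f {w, b, a})"
  have "poly ?D x \<ge> 0" for x
  proof -
    let ?c = "(\<lambda>_. x)(a := x + poly ?s x)"
    have upd: "wmatch ?c (del_verts G X) = poly (?f X + ?s * ?f (insert a X)) x" if "a \<notin> X" for X
      using wmatch_upd[of "del_verts G X" a x "poly ?s x"] assms(1,2) that
      by (simp only: poly_add poly_mult) simp
    have "0 \<le> wmatch ?c (del_verts G {w}) * wmatch ?c (del_verts G {b})
        - wmatch ?c G * wmatch ?c (del_verts G {w, b})"
      by (rule order_trans[OF _ rayleigh_weighted[OF assms(1,4,3,6)]]) simp
    moreover have "wmatch ?c G = poly (match_poly G + ?s * ?f {a}) x"
      using upd[of "{}"] by simp
    ultimately show ?thesis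
      using upd[of "{w}"] upd[of "{b}"] upd[of "{w, b}"] assms(5,7)
      by (simp add: insert_commute)
  qed
  moreover have "?D = ?t ^ ((j + 1) + (j + 1)) * ((fw + [:s:] * fwa) * (fb + ?s * fba)
      - ?t * (h + [:s:] * fa) * (fwb + [:s:] * fwba))"
    unfolding h fw fa fb(1) fwa(1) fba fwb fwba
    by (simp only: power_add power_one_right power2_eq_square algebra_simps)
  ultimately have "poly ((fw + [:s:] * fwa) * (fb + ?s * fba)
      - ?t * (h + [:s:] * fa) * (fwb + [:s:] * fwba)) \<theta> \<ge> 0" by (rule cofactor_nonneg)
  then have "(poly fw \<theta> + s * poly fwa \<theta>) * poly fb \<theta> \<ge> 0" by simp
  moreover have "poly fw \<theta> + s * poly fwa \<theta> = - poly fb \<theta>"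
    using fwa(2) by (simp add: s_def)
  ultimately show False using fb(2)
    by (auto simp: mult_le_0_iff zero_le_mult_iff)
qed

subsection \<open>Special vertices and components\<close>

lemma special_setD:
  assumes "simple_graph G" "a \<in> special_set \<theta> G"
  obtains w where "a \<in> fst G" "w \<in> fst G" "w \<in> nbrs G a" "a \<noteq> w"
    "mult \<theta> (del_verts G {w}) + 1 = mult \<theta> G" "mult \<theta> G \<le> mult \<theta> (del_verts G {a})"
proof -
  from assms(2) obtain w where w: "a \<in> fst G" "\<not> essential \<theta> G a" "w \<in> fst G" "essential \<theta> G w" "{a, w} \<in> snd G"
    unfolding special_set_def by blast
  show ?thesis
  proof (rule that[OF w(1,3)])
    show "w \<in> nbrs G a" using w(5) by (simp add: nbrs_def)
    show "a \<noteq> w" using w(2,4) by blast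
    show "mult \<theta> (del_verts G {w}) + 1 = mult \<theta> G" using w(4) by (simp only: essential_def)
    show "mult \<theta> G \<le> mult \<theta> (del_verts G {a})"
      using w(2) mult_le_del[OF assms(1) w(1), of \<theta>] unfolding essential_def by linarith
  qed
qed

text \<open>An essential neighbour of a stays essential after the deletion of a, and
  \<open>mult_del_essential_nbr\<close> then shows that a is positive, not merely neutral.\<close>

lemma mult_del_special:
  assumes "simple_graph G" "a \<in> special_set \<theta> G"
  shows "mult \<theta> (del_verts G {a}) = mult \<theta> G + 1"
proof -
  obtain w where w: "a \<in> fst G" "w \<in> fst G" "w \<in> nbrs G a" "a \<noteq> w"
    "mult \<theta> (del_verts G {w}) + 1 = mult \<theta> G" "mult \<theta> G \<le> mult \<theta> (del_verts G {a})"
    by (rule special_setD[OF assms])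
  from mult_del_essential_nbr[OF assms(1) w(1,3) mult_del_essential_comm[OF assms(1) w(1,2,4,5,6)]]
  show ?thesis by (rule sym)
qed

text \<open>The essential neighbour z of b stays essential, so the only danger is that b itself
  becomes essential. In that case b would be parallel, in G without a, to every other neighbour of
  a; by transitivity w would be parallel to all of them too, which contradicts the recursion at a in
  G without w.\<close>

lemma special_del_special:
  assumes G: "simple_graph G" and a: "a \<in> special_set \<theta> G" and b: "b \<in> special_set \<theta> G"
    and ab: "a \<noteq> b"
  shows "b \<in> special_set \<theta> (del_verts G {a})"
proof -
  define m where "m = mult \<theta> G"
  obtain w where w: "a \<in> fst G" "w \<in> fst G" "w \<in> nbrs G a" "a \<noteq> w"
    "mult \<theta> (del_verts G {w}) + 1 = mult \<theta> G" "mult \<theta> G \<le> mult \<theta> (del_verts G {a})"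
    by (rule special_setD[OF G a])
  obtain z where z: "b \<in> fst G" "z \<in> fst G" "z \<in> nbrs G b" "b \<noteq> z"
    "mult \<theta> (del_verts G {z}) + 1 = mult \<theta> G" "mult \<theta> G \<le> mult \<theta> (del_verts G {b})"
    by (rule special_setD[OF G b])
  have ma: "mult \<theta> (del_verts G {a}) = m + 1" and mb: "mult \<theta> (del_verts G {b}) = m + 1"
    using mult_del_special[OF G a] mult_del_special[OF G b] by (simp_all add: m_def)
  have "a \<noteq> z" using z(5) w(6) by auto
  have "b \<noteq> w" using w(5) z(6) by auto
  have maw: "mult \<theta> (del_verts G {a, w}) = m"
    using mult_del_essential_comm[OF G w(1,2,4,5,6)] ma by simp
  have maz: "mult \<theta> (del_verts G {a, z}) + 1 = mult \<theta> (del_verts G {a})"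
    by (rule mult_del_essential_comm[OF G w(1) z(2) \<open>a \<noteq> z\<close> z(5) w(6)])
  let ?K = "del_verts G {a}"
  have K: "simple_graph ?K" using G by simp
  have "mult \<theta> (del_verts G {a, b}) \<noteq> m"
  proof
    assume mab: "mult \<theta> (del_verts G {a, b}) = m"
    \<comment> \<open>Otherwise y would be essential after deleting b and a, and
      \<open>mult_del_essential_nbr\<close> would force multiplicity m - 1 for G without b, against
      \<open>mb\<close>.\<close>
    have nb: "m \<le> mult \<theta> (del_verts G {a, b, y})" if y: "y \<in> nbrs G a" "y \<noteq> b" for y
    proof (rule ccontr)
      assume less: "\<not> ?thesis"
      have "mult \<theta> (del_verts G {a, b}) \<le> mult \<theta> (del_verts G {a, b, y}) + 1"
        using mult_le_del[of "del_verts G {a, b}" y \<theta>] nbrs_in[OF G y(1)] y(2) G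
        by (simp add: insert_commute)
      with less mab have "mult \<theta> (del_verts (del_verts G {b}) {a, y}) + 1
          = mult \<theta> (del_verts (del_verts G {b}) {a})"
        by (simp add: insert_commute)
      from mult_del_essential_nbr[OF _ _ _ this] have "mult \<theta> (del_verts G {b}) + 1 = m"
        using G w(1) ab y mab by (simp add: nbrs_del insert_commute)
      with mb show False by simp
    qed
    \<comment> \<open>If no such y existed, all terms of the recursion at a in G without w would
      have order at least m, although w is essential.\<close>
    have "\<exists>y\<in>nbrs G a - {w}. mult \<theta> (del_verts G {a, w, y}) < m"
    proof (rule ccontr)
      assume no: "\<not> ?thesis"
      have "m \<le> mult \<theta> (del_verts G {w})"
      proof (rule mult_del_le_if)
        show "m \<le> mult \<theta> (del_verts (del_verts G {w}) {a})" using maw by (simp add: insert_commute)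
        show "m \<le> mult \<theta> (del_verts (del_verts G {w}) {a, y})" if "y \<in> nbrs (del_verts G {w}) a" for y
          using no that w(4) by (auto simp: nbrs_del insert_commute not_less)
      qed (use G w in simp_all)
      with w(5) show False by (simp add: m_def)
    qed
    then obtain y where y: "y \<in> nbrs G a" "y \<noteq> w" "mult \<theta> (del_verts G {a, w, y}) < m" by auto
    have "y \<noteq> b"
      using nb[OF w(3)] \<open>b \<noteq> w\<close> y(3) by (auto simp: insert_commute)
    have "y \<in> fst G" "y \<noteq> a" using nbrs_in[OF G y(1)] by auto
    \<comment> \<open>Both w and y are parallel to b in \<open>?K\<close>, hence to each
      other.\<close>
    have "mult \<theta> ?K \<le> mult \<theta> (del_verts ?K {w, y}) + 1"
    proof (rule parallel_trans[OF K])
      show "mult \<theta> (del_verts ?K {b}) + 1 = mult \<theta> ?K"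
        using ma mab by (simp add: insert_commute)
      show "mult \<theta> ?K \<le> mult \<theta> (del_verts ?K {b, w}) + 1"
        using ma nb[OF w(3)] \<open>b \<noteq> w\<close> by (simp add: insert_commute)
      show "mult \<theta> ?K \<le> mult \<theta> (del_verts ?K {b, y}) + 1"
        using ma nb[OF y(1)] \<open>y \<noteq> b\<close> by (simp add: insert_commute)
    qed (use w z ab y(2) \<open>y \<noteq> b\<close> \<open>y \<in> fst G\<close> \<open>y \<noteq> a\<close> \<open>b \<noteq> w\<close> in auto)
    with y(3) ma show False by (simp add: insert_commute)
  qed
  then have "\<not> essential \<theta> ?K b"
    using ma by (simp add: essential_def insert_commute)
  moreover have "essential \<theta> ?K z"
    using maz by (simp add: essential_def insert_commute)
  moreover have "{b, z} \<in> snd ?K" using z(3) \<open>a \<noteq> z\<close> ab by (auto simp: nbrs_def)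
  ultimately show ?thesis
    using z(1,2) ab \<open>a \<noteq> z\<close> by (auto simp: special_set_def)
qed

theorem mult_del_special_set:
  assumes "simple_graph G" "finite X" "X \<subseteq> special_set \<theta> G"
  shows "mult \<theta> (del_verts G X) = mult \<theta> G + card X"
proof -
  \<comment> \<open>The second conjunct keeps the vertices still to be deleted special, so that
    \<open>mult_del_special\<close> applies at every stage.\<close>
  have "mult \<theta> (del_verts G X) = mult \<theta> G + card X \<and>
    special_set \<theta> G - X \<subseteq> special_set \<theta> (del_verts G X)"
    using assms(2,3)
  proof (induction X rule: finite_induct)
    case (insert a X)
    then have IH: "mult \<theta> (del_verts G X) = mult \<theta> G + card X"
      "special_set \<theta> G - X \<subseteq> special_set \<theta> (del_verts G X)" by auto
    have G': "simple_graph (del_verts G X)" using assms(1) by simp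
    have a: "a \<in> special_set \<theta> (del_verts G X)" using IH(2) insert by auto
    have "mult \<theta> (del_verts G (insert a X)) = mult \<theta> (del_verts G X) + 1"
      using mult_del_special[OF G' a] by simp
    moreover have "b \<in> special_set \<theta> (del_verts G (insert a X))"
      if "b \<in> special_set \<theta> G - insert a X" for b
      using special_del_special[OF G' a, of b] IH(2) that by auto
    ultimately show ?case using IH(1) insert by auto
  qed simp
  then show ?thesis ..
qed

section \<open>Multiplicities and components\<close>

lemma match_poly_disjoint:
  assumes "simple_graph G" "fst G = C \<union> D" "C \<inter> D = {}"
    and "\<And>e. e \<in> snd G \<Longrightarrow> e \<inter> C = {} \<or> e \<inter> D = {}"
  shows "match_poly G = match_poly (del_verts G D) * match_poly (del_verts G C)"
  using assms
proof (induction arbitrary: C D rule: graph_induct)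
  case (less G)
  show ?case
  proof (cases "C = {}")
    case True
    have "match_poly (del_verts G D) = 1"
    proof -
      have "poly (match_poly (del_verts G D)) x = 1" for x
      proof -
        have "snd (del_verts G D) = {}"
          using edge_subset[of "del_verts G D"] edge_card[of "del_verts G D"] less(1,3) True by fastforce
        then have "matchings (del_verts G D) = {{}}" by (auto simp: matchings_def)
        then show ?thesis
          using less(1,3) True by (simp add: poly_match_poly wmatch_def)
      qed
      then show ?thesis by (intro iffD1[OF poly_eq_poly_eq_iff] ext) simp
    qed
    with True show ?thesis by simp
  next
    case False
    then obtain u where u: "u \<in> C" by blast
    have uG: "u \<in> fst G" using u less(3) by simp
    have uD: "u \<notin> D" using u less(4) by blast
    \<comment> \<open>All neighbours of u lie in C, so the factor belonging to D is common to every
      term of the recursion at u.\<close>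
    have N: "nbrs G u \<subseteq> C"
    proof
      fix w assume w: "w \<in> nbrs G u"
      then have "{u, w} \<inter> D = {}" using less(5)[of "{u, w}"] u by (auto simp: nbrs_def)
      then show "w \<in> C" using nbrs_in[OF less(1) w] less(3) by auto
    qed
    have IH: "match_poly (del_verts G X)
        = match_poly (del_verts (del_verts G D) X) * match_poly (del_verts G C)"
      if "u \<in> X" "X \<subseteq> C" for X
    proof -
      have "match_poly (del_verts G X) = match_poly (del_verts (del_verts G X) D)
          * match_poly (del_verts (del_verts G X) (C - X))"
      proof (rule less(2))
        show "X \<inter> fst G \<noteq> {}" using that uG by auto
        show "fst (del_verts G X) = (C - X) \<union> D" "(C - X) \<inter> D = {}"
          using less(3,4) that(2) by auto
        show "e \<inter> (C - X) = {} \<or> e \<inter> D = {}" if "e \<in> snd (del_verts G X)" for e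
          using less(5)[of e] that by auto
      qed
      moreover have "X \<union> (C - X) = C" using that(2) by auto
      ultimately show ?thesis by (simp add: Un_commute)
    qed
    have "match_poly G = [:0, 1:] * (match_poly (del_verts (del_verts G D) {u}) * match_poly (del_verts G C))
        - (\<Sum>w\<in>nbrs G u. match_poly (del_verts (del_verts G D) {u, w}) * match_poly (del_verts G C))"
      unfolding match_poly_rec[OF less(1) uG]
      using IH[of "{u}"] IH[of "{u, _}"] u N
      by (intro arg_cong2[of _ _ _ _ "(-)"] arg_cong2[of _ _ _ _ "(*)"] sum.cong refl) auto
    also have "\<dots> = ([:0, 1:] * match_poly (del_verts (del_verts G D) {u})
        - (\<Sum>w\<in>nbrs (del_verts G D) u. match_poly (del_verts (del_verts G D) {u, w})))
        * match_poly (del_verts G C)"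
    proof -
      have "nbrs (del_verts G D) u = nbrs G u" using N less(4) uD by (auto simp: nbrs_del)
      then show ?thesis by (simp only: left_diff_distrib sum_distrib_right mult.assoc)
    qed
    also have "\<dots> = match_poly (del_verts G D) * match_poly (del_verts G C)"
      using match_poly_rec[of "del_verts G D" u] less(1) uG uD by simp
    finally show ?thesis .
  qed
qed

lemma mult_disjoint:
  assumes "simple_graph G" "C \<subseteq> fst G" "\<And>e. e \<in> snd G \<Longrightarrow> e \<inter> C = {} \<or> e \<subseteq> C"
  shows "mult \<theta> G = mult \<theta> (induced G C) + mult \<theta> (del_verts G C)"
proof -
  let ?D = "fst G - C"
  have "e \<subseteq> C \<longleftrightarrow> e \<inter> ?D = {}" if "e \<in> snd G" for e
    using edge_subset[OF assms(1) that] by auto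
  then have ind: "induced G C = del_verts G ?D"
    using assms(2) by (auto simp: induced_def del_verts_def)
  have "match_poly G = match_poly (del_verts G ?D) * match_poly (del_verts G C)"
    by (rule match_poly_disjoint[OF assms(1)]) (use assms in auto)
  then show ?thesis
    unfolding mult_def ind using assms(1)
    by (metis match_poly_nonzero order_mult)
qed

lemma component_subset: "C \<in> components G \<Longrightarrow> C \<subseteq> fst G"
  by (auto simp: components_def)

lemma component_edge:
  assumes "simple_graph G" "C \<in> components G" "e \<in> snd G"
  shows "e \<inter> C = {} \<or> e \<subseteq> C"
proof -
  obtain x where x: "C = {y \<in> fst G. (adj G)\<^sup>*\<^sup>* x y}"
    using assms(2) by (auto simp: components_def)
  obtain y z where yz: "e = {y, z}" "y \<in> fst G" "z \<in> fst G"
    using edgeE[OF assms(1,3)] by metis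
  have "adj G y z" "adj G z y"
    using assms(3) by (auto simp: adj_def yz(1) insert_commute)
  then have "(adj G)\<^sup>*\<^sup>* x y \<longleftrightarrow> (adj G)\<^sup>*\<^sup>* x z"
    by (meson rtranclp.rtrancl_into_rtrancl)
  then show ?thesis using yz by (auto simp: x)
qed

text \<open>The last summand is independent of Y. Comparing the cases of empty and singleton Y shows
  that a vertex changes the multiplicity of G exactly as it changes that of its component.\<close>

lemma mult_component_del:
  assumes "simple_graph G" "C \<in> components G" "Y \<subseteq> C"
  shows "mult \<theta> (del_verts G Y) = mult \<theta> (del_verts (induced G C) Y) + mult \<theta> (del_verts G C)"
proof -
  have "mult \<theta> (del_verts G Y)
      = mult \<theta> (induced (del_verts G Y) (C - Y)) + mult \<theta> (del_verts (del_verts G Y) (C - Y))"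
    using component_edge[OF assms(1,2)] component_subset[OF assms(2)] assms(1)
    by (intro mult_disjoint) auto
  moreover have "Y \<union> (C - Y) = C" using assms(3) by auto
  moreover have "induced (del_verts G Y) (C - Y) = del_verts (induced G C) Y"
    by (auto simp: induced_def del_verts_def)
  ultimately show ?thesis by simp
qed

lemma component_reachable:
  assumes "C \<in> components G" "x \<in> C" "y \<in> C" "simple_graph G"
  shows "(adj G)\<^sup>*\<^sup>* x y"
proof -
  obtain z where z: "(adj G)\<^sup>*\<^sup>* z x" "(adj G)\<^sup>*\<^sup>* z y"
    using assms(1-3) by (auto simp: components_def)
  have "symp (adj G)" by (auto simp: symp_def adj_def insert_commute)
  then have "(adj G)\<^sup>*\<^sup>* x z" using z(1) by (meson symp_rtranclp sympD)
  then show ?thesis using z(2) by simp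
qed

text \<open>The vertices of a component all of whose vertices are essential behave like a parallel class
  of a matroid, so deleting two of them lowers the multiplicity by at most one.\<close>

lemma mult_del_pair_component:
  assumes G: "simple_graph G" and C: "C \<in> components G"
    and ess: "\<And>z. z \<in> C \<Longrightarrow> mult \<theta> (del_verts G {z}) + 1 = mult \<theta> G"
    and xy: "x \<in> C" "y \<in> C" "x \<noteq> y"
  shows "mult \<theta> G \<le> mult \<theta> (del_verts G {x, y}) + 1"
proof -
  have "(adj G)\<^sup>*\<^sup>* x y" by (rule component_reachable[OF C xy(1,2) G])
  \<comment> \<open>Induction along a path from x, with y as the moving endpoint. The alternative x
    = y covers the start and returns of the path to x.\<close>
  then have "y \<in> C \<and> (x = y \<or> mult \<theta> G \<le> mult \<theta> (del_verts G {x, y}) + 1)"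
  proof (induction rule: rtranclp_induct)
    case base
    then show ?case using xy(1) by simp
  next
    case (step y z)
    have e: "{y, z} \<in> snd G" using step(2) by (simp add: adj_def)
    have yz: "y \<in> C" "z \<in> C" "y \<noteq> z"
      using component_edge[OF G C e] step(3) edge_doubleton[OF G e] by auto
    have sub: "C \<subseteq> fst G" by (rule component_subset[OF C])
    show ?case
    proof (cases "x = z \<or> x = y")
      case True
      then show ?thesis using yz mult_del_edge[OF G e, of \<theta>] by auto
    next
      case False
      have "mult \<theta> G \<le> mult \<theta> (del_verts G {x, z}) + 1"
      proof (rule parallel_trans[OF G])
        show "mult \<theta> (del_verts G {y}) + 1 = mult \<theta> G" by (rule ess[OF yz(1)])
        show "mult \<theta> G \<le> mult \<theta> (del_verts G {y, x}) + 1"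
          using step(3) False by (simp add: insert_commute)
        show "mult \<theta> G \<le> mult \<theta> (del_verts G {y, z}) + 1" by (rule mult_del_edge[OF G e])
      qed (use False yz xy(1) sub in auto)
      with yz show ?thesis by simp
    qed
  qed
  with xy(3) show ?thesis by simp
qed

text \<open>Put the vertices of B back one at a time. The bound by \<open>card B\<close> keeps the
  multiplicity positive before each step, so an essential vertex exists; it is a neighbour of the
  returning vertex, and \<open>mult_del_essential_nbr\<close> gives a drop of exactly one.\<close>

lemma mult_del_universal:
  assumes "simple_graph G" "finite B" "B \<subseteq> fst G"
    and "\<And>a z. a \<in> B \<Longrightarrow> z \<in> fst G \<Longrightarrow> z \<noteq> a \<Longrightarrow> {a, z} \<in> snd G"
    and "card B \<le> mult \<theta> (del_verts G B)"
  shows "mult \<theta> (del_verts G B) = mult \<theta> G + card B"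
  using assms(2-)
proof (induction B rule: finite_induct)
  case (insert a B)
  let ?F = "del_verts G B"
  have F: "simple_graph ?F" "a \<in> fst ?F" using assms(1) insert by auto
  have Fa: "del_verts ?F {a} = del_verts G (insert a B)" by simp
  have "1 \<le> mult \<theta> (del_verts ?F {a})" using insert by simp
  then obtain w where w: "w \<in> fst (del_verts ?F {a})"
    "mult \<theta> (del_verts (del_verts ?F {a}) {w}) + 1 = mult \<theta> (del_verts ?F {a})"
    by (rule exists_essential[OF simple_del_verts[OF F(1)]])
  have "w \<in> nbrs ?F a" using w(1) insert by (auto simp: nbrs_def)
  moreover have "mult \<theta> (del_verts ?F {a, w}) + 1 = mult \<theta> (del_verts ?F {a})"
    using w(2) by (simp add: insert_commute)
  ultimately have drop: "mult \<theta> ?F + 1 = mult \<theta> (del_verts G (insert a B))"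
    using mult_del_essential_nbr[OF F] Fa by metis
  have "mult \<theta> ?F = mult \<theta> G + card B"
    by (rule insert.IH) (use insert drop in auto)
  with drop insert show ?case by simp
qed simp

section \<open>The graph with universal special vertices, and the conclusion\<close>

lemma simple_S_graph:
  assumes "simple_graph G"
  shows "simple_graph (S_graph \<theta> G)"
  unfolding simple_graph_def
proof (intro conjI ballI)
  show "finite (fst (S_graph \<theta> G))" using assms by (simp add: S_graph_def finite_verts)
  fix e assume "e \<in> snd (S_graph \<theta> G)"
  then consider "e \<in> snd G"
    | w z where "e = {w, z}" "w \<in> special_set \<theta> G" "z \<in> fst G" "z \<noteq> w"
    by (auto simp: S_graph_def)
  then show "\<exists>x y. x \<noteq> y \<and> e = {x, y} \<and> x \<in> fst (S_graph \<theta> G) \<and> y \<in> fst (S_graph \<theta> G)"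
  proof cases
    case 1
    then show ?thesis using assms by (simp add: S_graph_def simple_graph_def)
  next
    case 2
    then show ?thesis by (intro exI[of _ w] exI[of _ z]) (simp add: S_graph_def special_set_def)
  qed
qed

theorem theorem4p7:
  fixes G :: "'a graph" and \<theta> :: real and u v :: 'a
  defines "A \<equiv> special_set \<theta> G"
  assumes "simple_graph G"
    and "u \<in> fst G" and "v \<in> fst G" and "u \<noteq> v"
    and "(u \<in> fst G - A \<and>
          (\<exists>Q\<in>components (del_verts G A).
              mult \<theta> (induced (del_verts G A) Q) = 0 \<and> v \<in> Q))
       \<or> (\<exists>H\<in>components (del_verts G A).
              critical \<theta> (induced (del_verts G A) H) \<and> u \<in> H \<and> v \<in> H)
       \<or> (mult \<theta> G \<ge> 2 \<and>
          (\<exists>H1\<in>components (del_verts G A). \<exists>H2\<in>components (del_verts G A).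
              critical \<theta> (induced (del_verts G A) H1) \<and>
              critical \<theta> (induced (del_verts G A) H2) \<and>
              H1 \<noteq> H2 \<and> u \<in> H1 \<and> v \<in> H2))"
  shows "mult \<theta> (del_verts (S_graph \<theta> G) (A \<union> {u, v}))
           = mult \<theta> (del_verts (S_graph \<theta> G) {u, v}) + card A"
proof -
  let ?K = "del_verts G A"
  let ?F = "del_verts (S_graph \<theta> G) {u, v}"
  have A: "A \<subseteq> fst G" by (auto simp: A_def special_set_def)
  have fin: "finite A" using A finite_verts[OF assms(2)] by (rule finite_subset)
  have K: "simple_graph ?K" using assms(2) by simp
  have mK: "mult \<theta> ?K = mult \<theta> G + card A"
    using mult_del_special_set[OF assms(2) fin] by (simp add: A_def)
  have uv: "u \<in> fst ?K" "v \<in> fst ?K"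
    using assms(3,6) component_subset[of _ ?K] by auto
  have del2: "mult \<theta> (del_verts ?K {v}) \<le> mult \<theta> (del_verts ?K {u, v}) + 1"
    using mult_le_del[of "del_verts ?K {v}" u \<theta>] assms(2) uv \<open>u \<noteq> v\<close>
    by (simp add: insert_commute)
  have "card A \<le> mult \<theta> (del_verts ?K {u, v})"
  \<comment> \<open>For empty A the bound is trivial. Otherwise a special vertex has an essential
    neighbour, so \<theta> is a root of the matching polynomial of G; this spare unit pays for the
    loss in the first two cases.\<close>
  proof (cases "A = {}")
    case False
    then obtain a where "a \<in> special_set \<theta> G" by (auto simp: A_def)
    then have "1 \<le> mult \<theta> G" by (rule special_setD[OF assms(2)]) linarith
    from assms(6) show ?thesis
    proof (elim disjE conjE bexE)
      fix Q assume Q: "Q \<in> components ?K" "mult \<theta> (induced ?K Q) = 0" "v \<in> Q"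
      \<comment> \<open>The component Q contributes multiplicity 0, so deleting v loses nothing and
        only u can cost one.\<close>
      have "mult \<theta> ?K \<le> mult \<theta> (del_verts ?K {v})"
        using mult_component_del[OF K Q(1), of "{}" \<theta>] mult_component_del[OF K Q(1), of "{v}" \<theta>] Q(2,3)
        by simp
      with del2 mK \<open>1 \<le> mult \<theta> G\<close> show ?thesis by linarith
    next
      fix H assume H: "H \<in> components ?K" "critical \<theta> (induced ?K H)" "u \<in> H" "v \<in> H"
      \<comment> \<open>Criticality of H is transferred to \<open>?K\<close>, where
        \<open>mult_del_pair_component\<close> bounds the joint loss of u and v by one.\<close>
      have "mult \<theta> (del_verts ?K {z}) + 1 = mult \<theta> ?K" if "z \<in> H" for z
      proof -
        have "mult \<theta> (del_verts (induced ?K H) {z}) + 1 = mult \<theta> (induced ?K H)"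
          using H(2) that by (simp add: critical_def essential_def induced_def)
        then show ?thesis
          using mult_component_del[OF K H(1), of "{}" \<theta>] mult_component_del[OF K H(1), of "{z}" \<theta>] that
          by simp
      qed
      from mult_del_pair_component[OF K H(1) this H(3,4) \<open>u \<noteq> v\<close>]
      show ?thesis using mK \<open>1 \<le> mult \<theta> G\<close> by linarith
    next
      assume "2 \<le> mult \<theta> G"
      \<comment> \<open>Two deletions cost at most two, which the multiplicity of G covers.\<close>
      with del2 mK mult_le_del[OF K uv(2), of \<theta>] show ?thesis by linarith
    qed
  qed simp
  \<comment> \<open>Every added edge meets A, so the two graphs agree once A is deleted.\<close>
  moreover have "del_verts (S_graph \<theta> G) (A \<union> {u, v}) = del_verts ?K {u, v}"
    by (auto simp: del_verts_def S_graph_def A_def)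
  ultimately have le: "card A \<le> mult \<theta> (del_verts ?F A)"
    by (simp add: Un_commute)
  have "mult \<theta> (del_verts ?F A) = mult \<theta> ?F + card A"
  proof (rule mult_del_universal[OF _ fin _ _ le])
    show "simple_graph ?F" using simple_S_graph[OF assms(2)] by simp
    show "A \<subseteq> fst ?F" using A uv by (auto simp: S_graph_def)
    show "{a, z} \<in> snd ?F" if "a \<in> A" "z \<in> fst ?F" "z \<noteq> a" for a z
      using that uv by (auto simp: S_graph_def A_def)
  qed
  then show ?thesis by (simp add: Un_commute)
qed

end
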